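(* Let $M=\mathcal{F}(P)$ be the monoid of all regressive functions on the finite poset $P$, under function composition. Then $X(M)$ is not linear if and only if $P$ contains two distinct, but not necessarily disjoint, "edges" $E_1=\{x_1<x_2\}$ and $E_2=\{y_1<y_2\}$. Equivalently, $X(M)$ is linear if and only if $P$ is a collection of mutually incomparable points together with at most one chain of length $2$.
   Context: A function $f:P\to P$ on a poset $P$ is regressive if $f(p)\leq p$ for all $p\in P$. An edge $\{x_1<x_2\}$ of $P$ is a two-element subset $\{x_1,x_2\}$ of $P$ with $x_1<x_2$. A chain is a linearly ordered subset, and its length is its number of elements. For a monoid $M$ and $m\in M$, put $mM=\{mx : x\in M\}$. $X(M)=\{mM : m\in M\}$ is viewed as a poset ordered by inclusion $\subseteq$; it is linear if any two of its elements are comparable under $\subseteq$. *)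

theory Defs
  imports "HOL-Algebra.Coset"
begin

text \<open>A poset is a carrier \<open>P\<close> with a relation \<open>r\<close> satisfying \<open>partial_order_on P r\<close>, where
  \<open>(x, y) \<in> r\<close> means \<open>x \<le> y\<close>. Functions \<open>P \<rightarrow> P\<close> are represented by the extensional functions
  \<open>P \<rightarrow>\<^sub>E P\<close>, so that two of them are equal iff they agree on \<open>P\<close>.\<close>

definition regressive_functions :: "'a set \<Rightarrow> 'a rel \<Rightarrow> ('a \<Rightarrow> 'a) set" where
  "regressive_functions P r = {f \<in> P \<rightarrow>\<^sub>E P. \<forall>p\<in>P. (f p, p) \<in> r}"

text \<open>Functions act on the right, i.e. the product \<open>f \<otimes> g\<close> is \<open>f\<close> followed by \<open>g\<close>. The order
  matters, since \<open>m M\<close> is a one-sided ideal. With the opposite order, the regressive functions on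
  the poset \<open>{a, b, c}\<close> with \<open>a < c\<close> and \<open>b < c\<close> only would have just two sets \<open>m M\<close>, which are
  comparable, although this poset has two edges.\<close>

definition regressive_monoid :: "'a set \<Rightarrow> 'a rel \<Rightarrow> ('a \<Rightarrow> 'a) monoid" where
  "regressive_monoid P r =
     \<lparr>carrier = regressive_functions P r,
      mult = (\<lambda>f g. compose P g f),
      one = (\<lambda>x\<in>P. x)\<rparr>"

lemma monoid_regressive_monoid:
  assumes "partial_order_on P r"
  shows "monoid (regressive_monoid P r)"
proof -
  have r: "trans r" "refl_on P r"
    using assms by (auto simp: partial_order_on_def preorder_on_def)
  show ?thesis
  proof (rule monoidI)
    fix f g
    assume "f \<in> carrier (regressive_monoid P r)" "g \<in> carrier (regressive_monoid P r)"
    then show "f \<otimes>\<^bsub>regressive_monoid P r\<^esub> g \<in> carrier (regressive_monoid P r)"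
      using r(1) by (auto simp: regressive_monoid_def regressive_functions_def compose_def
          PiE_iff extensional_def) (metis transE)
  next
    show "\<one>\<^bsub>regressive_monoid P r\<^esub> \<in> carrier (regressive_monoid P r)"
      using r(2) by (auto simp: regressive_monoid_def regressive_functions_def refl_on_def)
  next
    fix f g h
    assume "f \<in> carrier (regressive_monoid P r)"
    then show "f \<otimes>\<^bsub>regressive_monoid P r\<^esub> g \<otimes>\<^bsub>regressive_monoid P r\<^esub> h =
        f \<otimes>\<^bsub>regressive_monoid P r\<^esub> (g \<otimes>\<^bsub>regressive_monoid P r\<^esub> h)"
      by (auto simp: regressive_monoid_def regressive_functions_def compose_def fun_eq_iff PiE_iff)
  next
    fix f
    assume "f \<in> carrier (regressive_monoid P r)"
    then show "\<one>\<^bsub>regressive_monoid P r\<^esub> \<otimes>\<^bsub>regressive_monoid P r\<^esub> f = f"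
      and "f \<otimes>\<^bsub>regressive_monoid P r\<^esub> \<one>\<^bsub>regressive_monoid P r\<^esub> = f"
      by (auto simp: regressive_monoid_def regressive_functions_def compose_def fun_eq_iff
          PiE_iff extensional_def)
  qed
qed

definition principal_right_ideals :: "('a, 'b) monoid_scheme \<Rightarrow> 'a set set" where
  "principal_right_ideals M = {m <#\<^bsub>M\<^esub> carrier M | m. m \<in> carrier M}"

definition poset_edges :: "'a set \<Rightarrow> 'a rel \<Rightarrow> 'a set set" where
  "poset_edges P r = {{x, y} | x y. x \<in> P \<and> y \<in> P \<and> (x, y) \<in> r \<and> x \<noteq> y}"

text \<open>\<open>P\<close> is the disjoint union of a set \<open>A\<close> of points and at most one two-element chain \<open>C\<close>. The
  points of \<open>A\<close> are incomparable to one another and to the elements of the chain.\<close>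

definition points_and_at_most_one_2chain :: "'a set \<Rightarrow> 'a rel \<Rightarrow> bool" where
  "points_and_at_most_one_2chain P r \<longleftrightarrow>
     (\<exists>A C. P = A \<union> C \<and> A \<inter> C = {} \<and>
        (C = {} \<or> (C \<in> Chains r \<and> card C = 2)) \<and>
        (\<forall>a\<in>A. \<forall>p\<in>P. p \<noteq> a \<longrightarrow> (a, p) \<notin> r \<and> (p, a) \<notin> r))"

end

theory Submission
  imports Defs
begin

text \<open>Since functions act on the right, \<open>f\<close> lies in \<open>g M\<close> iff \<open>f\<close> is \<open>g\<close> followed by a regressive
  function, so \<open>f\<close> must identify all points that \<open>g\<close> identifies. For distinct edges \<open>x\<^sub>1 < x\<^sub>2\<close>
  and \<open>y\<^sub>1 < y\<^sub>2\<close>, the map moving only \<open>x\<^sub>2\<close>, to \<open>x\<^sub>1\<close>, does not identify \<open>y\<^sub>1\<close> with \<open>y\<^sub>2\<close>, and vice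
  versa; hence the two maps generate incomparable ideals. Conversely, every point moved by a
  regressive function yields an edge, so with at most one edge there is at most one regressive
  function besides the identity, and \<open>X(M)\<close> is a chain.\<close>

definition collapse :: "'a set \<Rightarrow> 'a \<Rightarrow> 'a \<Rightarrow> 'a \<Rightarrow> 'a" where
  "collapse P x y = (\<lambda>p\<in>P. if p = y then x else p)"

text \<open>Since \<open>f = f \<otimes> \<one>\<close> lies in its own ideal and, by associativity,
  right ideals absorb right factors, comparing two principal ideals reduces to testing a
  generator.\<close>

lemma (in monoid) l_coset_subset_iff:
  assumes "f \<in> carrier G" "g \<in> carrier G"
  shows "f <# carrier G \<subseteq> g <# carrier G \<longleftrightarrow> f \<in> g <# carrier G"
proof
  assume "f <# carrier G \<subseteq> g <# carrier G"
  moreover have "f \<in> f <# carrier G"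
    unfolding l_coset_def using assms(1) r_one[of f] one_closed by fastforce
  ultimately show "f \<in> g <# carrier G" by blast
next
  assume "f \<in> g <# carrier G"
  then obtain h where h: "h \<in> carrier G" "f = g \<otimes> h"
    by (auto simp: l_coset_def)
  show "f <# carrier G \<subseteq> g <# carrier G"
  proof
    fix u assume "u \<in> f <# carrier G"
    then obtain k where "k \<in> carrier G" "u = f \<otimes> k"
      by (auto simp: l_coset_def)
    with h assms have "h \<otimes> k \<in> carrier G" "u = g \<otimes> (h \<otimes> k)"
      by (auto simp: m_assoc)
    then show "u \<in> g <# carrier G"
      by (auto simp: l_coset_def)
  qed
qed

lemma carrier_regressive_monoid [simp]:
  "carrier (regressive_monoid P r) = regressive_functions P r"
  by (simp add: regressive_monoid_def)

lemma regressive_ideal_identifies: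
  assumes "f \<in> g <#\<^bsub>regressive_monoid P r\<^esub> regressive_functions P r"
    and "p \<in> P" "q \<in> P" "g p = g q"
  shows "f p = f q"
  using assms by (auto simp: l_coset_def regressive_monoid_def compose_def)

lemma collapse_regressive:
  assumes "partial_order_on P r" "x \<in> P" "(x, y) \<in> r"
  shows "collapse P x y \<in> regressive_functions P r"
  using assms
  by (auto simp: collapse_def regressive_functions_def partial_order_on_def preorder_on_def
      refl_on_def)

lemma collapse_not_in_ideal:
  assumes po: "partial_order_on P r"
    and "x1 \<in> P" "x2 \<in> P" "(x1, x2) \<in> r" "x1 \<noteq> x2"
    and "y1 \<in> P" "y2 \<in> P" "(y1, y2) \<in> r" "y1 \<noteq> y2"
    and "{x1, x2} \<noteq> {y1, y2}"
  shows "collapse P x1 x2 \<notin>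
    collapse P y1 y2 <#\<^bsub>regressive_monoid P r\<^esub> regressive_functions P r"
proof
  assume "collapse P x1 x2 \<in>
    collapse P y1 y2 <#\<^bsub>regressive_monoid P r\<^esub> regressive_functions P r"
  moreover have "collapse P y1 y2 y1 = collapse P y1 y2 y2"
    using assms by (auto simp: collapse_def)
  ultimately have "collapse P x1 x2 y1 = collapse P x1 x2 y2"
    using assms by (blast intro: regressive_ideal_identifies)
  moreover have "antisym r"
    using po by (auto simp: partial_order_on_def)
  \<comment> \<open>The map \<open>collapse P x1 x2\<close> identifies no two distinct points other
    than \<open>x1\<close> and \<open>x2\<close>, so equal values at \<open>y1\<close> and
    \<open>y2\<close> would make the two edges coincide.\<close>
  ultimately show False
    using assms by (auto simp: collapse_def antisym_def split: if_splits)
qed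

lemma regressive_moves_edge:
  assumes "f \<in> regressive_functions P r" "p \<in> P" "f p \<noteq> p"
  shows "{f p, p} \<in> poset_edges P r"
  using assms by (auto simp: regressive_functions_def poset_edges_def)

lemma regressive_ext:
  assumes "f \<in> regressive_functions P r" "g \<in> regressive_functions P r"
    and "\<And>p. p \<in> P \<Longrightarrow> f p = g p"
  shows "f = g"
  using assms by (auto simp: regressive_functions_def intro: PiE_ext)

lemma regressive_functions_unique_edge:
  assumes po: "partial_order_on P r"
    and one_edge: "\<And>E1 E2. E1 \<in> poset_edges P r \<Longrightarrow> E2 \<in> poset_edges P r \<Longrightarrow> E1 = E2"
    and f: "f \<in> regressive_functions P r" "f \<noteq> (\<lambda>x\<in>P. x)"
    and g: "g \<in> regressive_functions P r" "g \<noteq> (\<lambda>x\<in>P. x)"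
  shows "f = g"
proof -
  have id: "(\<lambda>x\<in>P. x) \<in> regressive_functions P r"
    using monoid.one_closed[OF monoid_regressive_monoid[OF po]]
    by (simp add: regressive_monoid_def)
  have same: "p = q \<and> f' p = g' q"
    if f': "f' \<in> regressive_functions P r" "p \<in> P" "f' p \<noteq> p"
      and g': "g' \<in> regressive_functions P r" "q \<in> P" "g' q \<noteq> q" for f' g' p q
  proof -
    have eq: "{f' p, p} = {g' q, q}"
      using regressive_moves_edge[OF f'] regressive_moves_edge[OF g'] by (rule one_edge)
    have le: "(f' p, p) \<in> r" "(g' q, q) \<in> r"
      using f' g' by (auto simp: regressive_functions_def)
    have "antisym r"
      using po by (auto simp: partial_order_on_def)
    \<comment> \<open>A crosswise match \<open>f' p = q\<close>, \<open>g' q = p\<close> would put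
      both \<open>(q, p)\<close> and \<open>(p, q)\<close> into \<open>r\<close>; antisymmetry
      excludes this, so the moved points agree and so do their images.\<close>
    with eq le f'(3) g'(3) show ?thesis
      by (auto simp: doubleton_eq_iff antisym_def)
  qed
  obtain p where p: "p \<in> P" "f p \<noteq> p"
    using f regressive_ext[OF f(1) id] by auto
  obtain q where q: "q \<in> P" "g q \<noteq> q"
    using g regressive_ext[OF g(1) id] by auto
  show ?thesis
  proof (rule regressive_ext[OF f(1) g(1)])
    fix z assume z: "z \<in> P"
    \<comment> \<open>If \<open>f\<close> moves \<open>z\<close>, comparison with \<open>q\<close>
      gives \<open>z = q\<close> and \<open>f z = g q\<close>; if \<open>g\<close> moves
      \<open>z\<close>, compare with \<open>p\<close>; otherwise both fix \<open>z\<close>.\<close>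
    show "f z = g z"
      using same[OF f(1) z _ g(1) q] same[OF f(1) p g(1) z] same[OF f(1) p g(1) q] by metis
  qed
qed

lemma regressive_ideals_chain_iff:
  assumes po: "partial_order_on P r"
  shows "chain\<^sub>\<subseteq> (principal_right_ideals (regressive_monoid P r)) \<longleftrightarrow>
    (\<forall>E1\<in>poset_edges P r. \<forall>E2\<in>poset_edges P r. E1 = E2)" (is "?L \<longleftrightarrow> ?R")
proof -
  let ?M = "regressive_monoid P r" and ?F = "regressive_functions P r"
  interpret monoid ?M by (rule monoid_regressive_monoid[OF po])
  have chain: "?L \<longleftrightarrow> (\<forall>f\<in>?F. \<forall>g\<in>?F. f \<in> g <#\<^bsub>?M\<^esub> ?F \<or> g \<in> f <#\<^bsub>?M\<^esub> ?F)"
    using l_coset_subset_iff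
    by (auto simp: chain_subset_def principal_right_ideals_def) blast+
  show ?thesis
  proof
    assume ?L
    show ?R
    proof (intro ballI)
      fix E1 E2 assume "E1 \<in> poset_edges P r" "E2 \<in> poset_edges P r"
      then obtain x1 x2 y1 y2 where
        x: "E1 = {x1, x2}" "x1 \<in> P" "x2 \<in> P" "(x1, x2) \<in> r" "x1 \<noteq> x2" and
        y: "E2 = {y1, y2}" "y1 \<in> P" "y2 \<in> P" "(y1, y2) \<in> r" "y1 \<noteq> y2"
        by (auto simp: poset_edges_def)
      show "E1 = E2"
      proof (rule ccontr)
        assume "E1 \<noteq> E2"
        then have ne: "{x1, x2} \<noteq> {y1, y2}" using x y by simp
        from collapse_not_in_ideal[OF po x(2-) y(2-) ne]
          collapse_not_in_ideal[OF po y(2-) x(2-) ne[symmetric]]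
        show False
          using \<open>?L\<close> collapse_regressive[OF po x(2,4)] collapse_regressive[OF po y(2,4)]
          unfolding chain by blast
      qed
    qed
  next
    assume R: ?R
    have top: "f \<in> (\<lambda>x\<in>P. x) <#\<^bsub>?M\<^esub> ?F" if "f \<in> ?F" for f
    proof -
      have "f = \<one>\<^bsub>?M\<^esub> \<otimes>\<^bsub>?M\<^esub> f" using that by simp
      moreover have "\<one>\<^bsub>?M\<^esub> = (\<lambda>x\<in>P. x)" by (simp add: regressive_monoid_def)
      ultimately show ?thesis using that by (auto simp: l_coset_def)
    qed
    have refl: "f \<in> f <#\<^bsub>?M\<^esub> ?F" if "f \<in> ?F" for f
      using l_coset_subset_iff[of f f] that by simp
    show ?L
      unfolding chain
    proof (intro ballI)
      fix f g assume "f \<in> ?F" "g \<in> ?F"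
      \<comment> \<open>Either one of the two is the identity, whose ideal is the whole monoid, or
        neither is and they coincide.\<close>
      then show "f \<in> g <#\<^bsub>?M\<^esub> ?F \<or> g \<in> f <#\<^bsub>?M\<^esub> ?F"
        using regressive_functions_unique_edge[OF po, of f g] R top refl by blast
    qed
  qed
qed

text \<open>Two distinct comparable points are exactly the endpoints of an edge, so the isolated
  points are those on no edge, and the chain \<open>C\<close>, if nonempty, is the only
  edge.\<close>

lemma points_and_at_most_one_2chain_iff:
  assumes po: "partial_order_on P r"
  shows "points_and_at_most_one_2chain P r \<longleftrightarrow>
    (\<forall>E1\<in>poset_edges P r. \<forall>E2\<in>poset_edges P r. E1 = E2)" (is "?L \<longleftrightarrow> ?R")
proof
  assume ?L
  then obtain A C where AC: "P = A \<union> C" "C = {} \<or> card C = 2"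
      "\<forall>a\<in>A. \<forall>p\<in>P. p \<noteq> a \<longrightarrow> (a, p) \<notin> r \<and> (p, a) \<notin> r"
    unfolding points_and_at_most_one_2chain_def by blast
  have "E = C" if E: "E \<in> poset_edges P r" for E
  proof -
    obtain x y where xy: "E = {x, y}" "x \<in> P" "y \<in> P" "(x, y) \<in> r" "x \<noteq> y"
      using E by (auto simp: poset_edges_def)
    then have "E \<subseteq> C" using AC(1,3) by auto
    moreover have "card E = 2" using xy by simp
    \<comment> \<open>The nonempty set \<open>E\<close> inside \<open>C\<close> rules out
      \<open>C = {}\<close>, and a nonzero \<open>card\<close> forces finiteness.\<close>
    moreover have "finite C" "card C = 2"
      using AC(2) \<open>E \<subseteq> C\<close> xy(1) by (auto intro: card_ge_0_finite)
    ultimately show ?thesis by (simp add: card_subset_eq)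
  qed
  then show ?R by metis
next
  assume R: ?R
  show ?L
  proof (cases "poset_edges P r = {}")
    case True
    then have isolated: "\<forall>a\<in>P. \<forall>p\<in>P. p \<noteq> a \<longrightarrow> (a, p) \<notin> r \<and> (p, a) \<notin> r"
      by (auto simp: poset_edges_def)
    show ?thesis
      unfolding points_and_at_most_one_2chain_def
      by (rule exI[of _ P], rule exI[of _ "{}"]) (use isolated in simp)
  next
    case False
    then obtain x y where xy: "x \<in> P" "y \<in> P" "(x, y) \<in> r" "x \<noteq> y"
      by (auto simp: poset_edges_def)
    have edge: "{p, q} = {x, y}" if "p \<in> P" "q \<in> P" "(p, q) \<in> r" "p \<noteq> q" for p q
    proof -
      have "{p, q} \<in> poset_edges P r" "{x, y} \<in> poset_edges P r"
        using that xy by (auto simp: poset_edges_def)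
      then show ?thesis by (rule R[rule_format])
    qed
    \<comment> \<open>Membership in \<open>Chains\<close> also compares each point with itself,
      which is where reflexivity enters.\<close>
    have chain: "{x, y} \<in> Chains r"
      using po xy by (auto simp: Chains_def partial_order_on_def preorder_on_def refl_on_def)
    have isolated: "\<forall>a\<in>P - {x, y}. \<forall>p\<in>P. p \<noteq> a \<longrightarrow> (a, p) \<notin> r \<and> (p, a) \<notin> r"
    proof (intro ballI impI)
      fix a p assume "a \<in> P - {x, y}" "p \<in> P" "p \<noteq> a"
      then show "(a, p) \<notin> r \<and> (p, a) \<notin> r"
        using edge[of a p] edge[of p a] by auto
    qed
    show ?thesis
      unfolding points_and_at_most_one_2chain_def
      by (rule exI[of _ "P - {x, y}"], rule exI[of _ "{x, y}"]) (use chain isolated xy in auto)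
  qed
qed

theorem theorem3p3:
  fixes P :: "'a set" and r :: "'a rel"
  assumes "partial_order_on P r"
    and "finite P"
  shows "(\<not> chain\<^sub>\<subseteq> (principal_right_ideals (regressive_monoid P r)) \<longleftrightarrow>
           (\<exists>E1 E2. E1 \<in> poset_edges P r \<and> E2 \<in> poset_edges P r \<and> E1 \<noteq> E2))
       \<and> (chain\<^sub>\<subseteq> (principal_right_ideals (regressive_monoid P r)) \<longleftrightarrow>
           points_and_at_most_one_2chain P r)"
  using regressive_ideals_chain_iff[OF assms(1)] points_and_at_most_one_2chain_iff[OF assms(1)]
  by blast

end
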